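(* Let $\mathsf{K}$ be an essentially small triangulated category. If the lattice $\mathrm{Thick}(\mathsf{K})$ of thick subcategories of $\mathsf{K}$ is distributive, then $\mathrm{Thick}(\mathsf{K})$ is a spatial frame.
   Context: A thick subcategory of a triangulated category $\mathsf{K}$ is a full subcategory closed under isomorphisms, all suspensions, cones and direct summands. $\mathrm{Thick}(\mathsf{K})$ is the poset of thick subcategories of $\mathsf{K}$ ordered by inclusion; it is a complete lattice with meets given by intersection and joins $\bigvee_\lambda \mathsf{M}_\lambda=\mathrm{thick}(\bigcup_\lambda \mathsf{M}_\lambda)$, where $\mathrm{thick}(C)$ is the smallest thick subcategory containing $C$. A frame is a complete lattice in which finite meets distribute over arbitrary joins. Let $\mathbf{2}=\{0\le 1\}$. A point of a frame $F$ is a poset map $p\colon F\to\mathbf{2}$ preserving finite meets (including the top) and arbitrary joins (including the bottom). A frame $F$ is spatial if whenever $a\nleq b$ in $F$ there exists a point $p\colon F\to \mathbf{2}$ with $p(a)=1$ and $p(b)=0$. *)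

theory Defs
  imports "HOL-Algebra.Group"
begin

section \<open>Categories, functors and equivalences\<close>

text \<open>
  A category is given by a set of objects and a set of arrows of some HOL types. Every such
  category is small relative to the ambient logic, so essential smallness needs no separate
  hypothesis: the thick subcategories below form a set, namely a set of sets of objects.
\<close>

record ('o, 'a) category_data =
  Obj :: "'o set"
  Arr :: "'a set"
  Dom :: "'a \<Rightarrow> 'o"
  Cod :: "'a \<Rightarrow> 'o"
  Idt :: "'o \<Rightarrow> 'a"
  Cmp :: "'a \<Rightarrow> 'a \<Rightarrow> 'a"  (infixr \<open>\<cdot>\<index>\<close> 75)

definition Hom :: "('o, 'a, 'z) category_data_scheme \<Rightarrow> 'o \<Rightarrow> 'o \<Rightarrow> 'a set" where
  "Hom C X Y = {f \<in> Arr C. Dom C f = X \<and> Cod C f = Y}"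

locale category =
  fixes C :: "('o, 'a, 'z) category_data_scheme" (structure)
  assumes dom_in_Obj: "f \<in> Arr C \<Longrightarrow> Dom C f \<in> Obj C"
    and cod_in_Obj: "f \<in> Arr C \<Longrightarrow> Cod C f \<in> Obj C"
    and idt_in_Hom: "X \<in> Obj C \<Longrightarrow> Idt C X \<in> Hom C X X"
    and cmp_in_Hom: "\<lbrakk>f \<in> Hom C X Y; g \<in> Hom C Y Z\<rbrakk> \<Longrightarrow> g \<cdot> f \<in> Hom C X Z"
    and idt_right: "f \<in> Hom C X Y \<Longrightarrow> f \<cdot> Idt C X = f"
    and idt_left: "f \<in> Hom C X Y \<Longrightarrow> Idt C Y \<cdot> f = f"
    and cmp_assoc: "\<lbrakk>f \<in> Hom C W X; g \<in> Hom C X Y; h \<in> Hom C Y Z\<rbrakk>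
                      \<Longrightarrow> (h \<cdot> g) \<cdot> f = h \<cdot> (g \<cdot> f)"

definition iso_arrow :: "('o, 'a, 'z) category_data_scheme \<Rightarrow> 'o \<Rightarrow> 'o \<Rightarrow> 'a \<Rightarrow> bool" where
  "iso_arrow C X Y f \<longleftrightarrow>
     f \<in> Hom C X Y \<and> (\<exists>g \<in> Hom C Y X. g \<cdot>\<^bsub>C\<^esub> f = Idt C X \<and> f \<cdot>\<^bsub>C\<^esub> g = Idt C Y)"

definition isomorphic_objects :: "('o, 'a, 'z) category_data_scheme \<Rightarrow> 'o \<Rightarrow> 'o \<Rightarrow> bool" where
  "isomorphic_objects C X Y \<longleftrightarrow> X \<in> Obj C \<and> Y \<in> Obj C \<and> (\<exists>f. iso_arrow C X Y f)"

definition zero_object :: "('o, 'a, 'z) category_data_scheme \<Rightarrow> 'o \<Rightarrow> bool" where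
  "zero_object C Z \<longleftrightarrow>
     Z \<in> Obj C \<and> (\<forall>X \<in> Obj C. (\<exists>!f. f \<in> Hom C X Z) \<and> (\<exists>!f. f \<in> Hom C Z X))"

definition endofunctor ::
    "('o, 'a, 'z) category_data_scheme \<Rightarrow> ('o \<Rightarrow> 'o) \<Rightarrow> ('a \<Rightarrow> 'a) \<Rightarrow> bool" where
  "endofunctor C F\<^sub>0 F\<^sub>1 \<longleftrightarrow>
     (\<forall>X \<in> Obj C. F\<^sub>0 X \<in> Obj C) \<and>
     (\<forall>X \<in> Obj C. \<forall>Y \<in> Obj C. \<forall>f \<in> Hom C X Y. F\<^sub>1 f \<in> Hom C (F\<^sub>0 X) (F\<^sub>0 Y)) \<and>
     (\<forall>X \<in> Obj C. F\<^sub>1 (Idt C X) = Idt C (F\<^sub>0 X)) \<and>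
     (\<forall>X \<in> Obj C. \<forall>Y \<in> Obj C. \<forall>Z \<in> Obj C. \<forall>f \<in> Hom C X Y. \<forall>g \<in> Hom C Y Z.
        F\<^sub>1 (g \<cdot>\<^bsub>C\<^esub> f) = F\<^sub>1 g \<cdot>\<^bsub>C\<^esub> F\<^sub>1 f)"

definition natural_iso ::
    "('o, 'a, 'z) category_data_scheme \<Rightarrow> ('o \<Rightarrow> 'o) \<Rightarrow> ('a \<Rightarrow> 'a) \<Rightarrow> ('o \<Rightarrow> 'o) \<Rightarrow> ('a \<Rightarrow> 'a)
       \<Rightarrow> ('o \<Rightarrow> 'a) \<Rightarrow> bool" where
  "natural_iso C F\<^sub>0 F\<^sub>1 G\<^sub>0 G\<^sub>1 \<eta> \<longleftrightarrow>
     (\<forall>X \<in> Obj C. iso_arrow C (F\<^sub>0 X) (G\<^sub>0 X) (\<eta> X)) \<and>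
     (\<forall>X \<in> Obj C. \<forall>Y \<in> Obj C. \<forall>f \<in> Hom C X Y. G\<^sub>1 f \<cdot>\<^bsub>C\<^esub> \<eta> X = \<eta> Y \<cdot>\<^bsub>C\<^esub> F\<^sub>1 f)"

definition autoequivalence ::
    "('o, 'a, 'z) category_data_scheme \<Rightarrow> ('o \<Rightarrow> 'o) \<Rightarrow> ('a \<Rightarrow> 'a) \<Rightarrow> bool" where
  "autoequivalence C F\<^sub>0 F\<^sub>1 \<longleftrightarrow>
     endofunctor C F\<^sub>0 F\<^sub>1 \<and>
     (\<exists>G\<^sub>0 G\<^sub>1 \<eta> \<epsilon>. endofunctor C G\<^sub>0 G\<^sub>1 \<and>
        natural_iso C (\<lambda>X. X) (\<lambda>f. f) (G\<^sub>0 \<circ> F\<^sub>0) (G\<^sub>1 \<circ> F\<^sub>1) \<eta> \<and>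
        natural_iso C (F\<^sub>0 \<circ> G\<^sub>0) (F\<^sub>1 \<circ> G\<^sub>1) (\<lambda>X. X) (\<lambda>f. f) \<epsilon>)"

section \<open>Additive categories\<close>

record ('o, 'a) preadditive_data = "('o, 'a) category_data" +
  Add :: "'a \<Rightarrow> 'a \<Rightarrow> 'a"
  Zer :: "'o \<Rightarrow> 'o \<Rightarrow> 'a"

definition Hom_group :: "('o, 'a, 'z) preadditive_data_scheme \<Rightarrow> 'o \<Rightarrow> 'o \<Rightarrow> 'a monoid" where
  "Hom_group C X Y = \<lparr>carrier = Hom C X Y, monoid.mult = Add C, one = Zer C X Y\<rparr>"

definition Neg :: "('o, 'a, 'z) preadditive_data_scheme \<Rightarrow> 'a \<Rightarrow> 'a" where
  "Neg C f = inv\<^bsub>Hom_group C (Dom C f) (Cod C f)\<^esub> f"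

locale preadditive_category = category C
  for C :: "('o, 'a, 'z) preadditive_data_scheme" (structure) +
  assumes Hom_comm_group: "\<lbrakk>X \<in> Obj C; Y \<in> Obj C\<rbrakk> \<Longrightarrow> comm_group (Hom_group C X Y)"
    and cmp_add_left: "\<lbrakk>f \<in> Hom C X Y; g \<in> Hom C Y Z; g' \<in> Hom C Y Z\<rbrakk>
           \<Longrightarrow> Add C g g' \<cdot> f = Add C (g \<cdot> f) (g' \<cdot> f)"
    and cmp_add_right: "\<lbrakk>f \<in> Hom C X Y; f' \<in> Hom C X Y; g \<in> Hom C Y Z\<rbrakk>
           \<Longrightarrow> g \<cdot> Add C f f' = Add C (g \<cdot> f) (g \<cdot> f')"

definition biproduct :: "('o, 'a, 'z) preadditive_data_scheme \<Rightarrow> 'o \<Rightarrow> 'o \<Rightarrow> 'o \<Rightarrow> bool" where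
  "biproduct C X Y B \<longleftrightarrow> X \<in> Obj C \<and> Y \<in> Obj C \<and> B \<in> Obj C \<and>
     (\<exists>i \<in> Hom C X B. \<exists>j \<in> Hom C Y B. \<exists>p \<in> Hom C B X. \<exists>q \<in> Hom C B Y.
        p \<cdot>\<^bsub>C\<^esub> i = Idt C X \<and> q \<cdot>\<^bsub>C\<^esub> j = Idt C Y \<and>
        p \<cdot>\<^bsub>C\<^esub> j = Zer C Y X \<and> q \<cdot>\<^bsub>C\<^esub> i = Zer C X Y \<and>
        Add C (i \<cdot>\<^bsub>C\<^esub> p) (j \<cdot>\<^bsub>C\<^esub> q) = Idt C B)"

locale additive_category = preadditive_category C
  for C :: "('o, 'a, 'z) preadditive_data_scheme" (structure) +
  assumes zero_object_exists: "\<exists>Z. zero_object C Z"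
    and biproduct_exists: "\<lbrakk>X \<in> Obj C; Y \<in> Obj C\<rbrakk> \<Longrightarrow> \<exists>B. biproduct C X Y B"

section \<open>Triangulated categories\<close>

text \<open>
  \<open>Sus0\<close> and \<open>Sus1\<close> are the action of the suspension on objects and arrows. A distinguished
  triangle \<open>X \<rightarrow> Y \<rightarrow> Z \<rightarrow> \<Sigma>X\<close> is recorded by its three arrows.
\<close>

record ('o, 'a) triangulated_data = "('o, 'a) preadditive_data" +
  Sus0 :: "'o \<Rightarrow> 'o"
  Sus1 :: "'a \<Rightarrow> 'a"
  Tri :: "('a \<times> 'a \<times> 'a) set"

definition triangle ::
    "('o, 'a, 'z) triangulated_data_scheme \<Rightarrow> 'o \<Rightarrow> 'o \<Rightarrow> 'o \<Rightarrow> 'a \<Rightarrow> 'a \<Rightarrow> 'a \<Rightarrow> bool" where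
  "triangle K X Y Z f g h \<longleftrightarrow> X \<in> Obj K \<and> Y \<in> Obj K \<and> Z \<in> Obj K \<and>
     f \<in> Hom K X Y \<and> g \<in> Hom K Y Z \<and> h \<in> Hom K Z (Sus0 K X)"

definition distinguished ::
    "('o, 'a, 'z) triangulated_data_scheme \<Rightarrow> 'o \<Rightarrow> 'o \<Rightarrow> 'o \<Rightarrow> 'a \<Rightarrow> 'a \<Rightarrow> 'a \<Rightarrow> bool" where
  "distinguished K X Y Z f g h \<longleftrightarrow> triangle K X Y Z f g h \<and> (f, g, h) \<in> Tri K"

text \<open>
  The suspension is only required to be an additive autoequivalence, not an automorphism.
  The axioms \<open>TR1\<close> to \<open>TR4\<close> are Verdier's; \<open>TR4\<close> is the octahedral axiom.
\<close>

locale triangulated_category = additive_category K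
  for K :: "('o, 'a, 'z) triangulated_data_scheme" (structure) +
  assumes suspension_autoequivalence: "autoequivalence K (Sus0 K) (Sus1 K)"
    and suspension_additive: "\<lbrakk>f \<in> Hom K X Y; g \<in> Hom K X Y\<rbrakk>
           \<Longrightarrow> Sus1 K (Add K f g) = Add K (Sus1 K f) (Sus1 K g)"
    and Tri_triangle: "(f, g, h) \<in> Tri K \<Longrightarrow> \<exists>X Y Z. triangle K X Y Z f g h"
    and TR1_iso: "\<lbrakk>distinguished K X Y Z f g h; triangle K X' Y' Z' f' g' h';
             iso_arrow K X X' a; iso_arrow K Y Y' b; iso_arrow K Z Z' c;
             b \<cdot> f = f' \<cdot> a; c \<cdot> g = g' \<cdot> b; Sus1 K a \<cdot> h = h' \<cdot> c\<rbrakk>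
           \<Longrightarrow> distinguished K X' Y' Z' f' g' h'"
    and TR1_idt: "\<lbrakk>X \<in> Obj K; zero_object K Z\<rbrakk>
           \<Longrightarrow> distinguished K X X Z (Idt K X) (Zer K X Z) (Zer K Z (Sus0 K X))"
    and TR1_cone: "\<lbrakk>X \<in> Obj K; Y \<in> Obj K; f \<in> Hom K X Y\<rbrakk>
           \<Longrightarrow> \<exists>Z g h. distinguished K X Y Z f g h"
    and TR2: "triangle K X Y Z f g h
           \<Longrightarrow> distinguished K X Y Z f g h
                 \<longleftrightarrow> distinguished K Y Z (Sus0 K X) g h (Neg K (Sus1 K f))"
    and TR3: "\<lbrakk>distinguished K X Y Z f g h; distinguished K X' Y' Z' f' g' h';
             a \<in> Hom K X X'; b \<in> Hom K Y Y'; b \<cdot> f = f' \<cdot> a\<rbrakk>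
           \<Longrightarrow> \<exists>c \<in> Hom K Z Z'. c \<cdot> g = g' \<cdot> b \<and> Sus1 K a \<cdot> h = h' \<cdot> c"
    and TR4: "\<lbrakk>distinguished K X Y U f u\<^sub>1 u\<^sub>2; distinguished K X Z V (g \<cdot> f) v\<^sub>1 v\<^sub>2;
             distinguished K Y Z W g w\<^sub>1 w\<^sub>2\<rbrakk>
           \<Longrightarrow> \<exists>s t. distinguished K U V W s t (Sus1 K u\<^sub>1 \<cdot> w\<^sub>2) \<and>
                 s \<cdot> u\<^sub>1 = v\<^sub>1 \<cdot> g \<and> v\<^sub>2 \<cdot> s = u\<^sub>2 \<and>
                 t \<cdot> v\<^sub>1 = w\<^sub>1 \<and> w\<^sub>2 \<cdot> t = Sus1 K f \<cdot> v\<^sub>2"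

section \<open>The poset of thick subcategories\<close>

text \<open>
  A full subcategory is identified with its set of objects. A subcategory contains the zero
  objects, so that the empty set is not thick. Closure under negative suspensions is the
  condition \<open>Sus0 K X \<in> M \<Longrightarrow> X \<in> M\<close>: since \<open>M\<close> is closed under isomorphisms, this says the
  same as \<open>Y \<in> M \<Longrightarrow> \<Sigma>\<^sup>-\<^sup>1 Y \<in> M\<close> for one, equivalently any, quasi-inverse of the suspension.
\<close>

definition thick_subcategory ::
    "('o, 'a, 'z) triangulated_data_scheme \<Rightarrow> 'o set \<Rightarrow> bool" where
  "thick_subcategory K M \<longleftrightarrow>
     M \<subseteq> Obj K \<and>
     (\<forall>Z. zero_object K Z \<longrightarrow> Z \<in> M) \<and>
     (\<forall>X Y. X \<in> M \<and> isomorphic_objects K X Y \<longrightarrow> Y \<in> M) \<and>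
     (\<forall>X \<in> M. Sus0 K X \<in> M) \<and>
     (\<forall>X \<in> Obj K. Sus0 K X \<in> M \<longrightarrow> X \<in> M) \<and>
     (\<forall>X Y Z f g h. distinguished K X Y Z f g h \<and> X \<in> M \<and> Y \<in> M \<longrightarrow> Z \<in> M) \<and>
     (\<forall>X Y B. biproduct K X Y B \<and> B \<in> M \<longrightarrow> X \<in> M \<and> Y \<in> M)"

definition Thick :: "('o, 'a, 'z) triangulated_data_scheme \<Rightarrow> 'o set gorder" where
  "Thick K = \<lparr>carrier = {M. thick_subcategory K M}, eq = (=), le = (\<subseteq>)\<rparr>"

section \<open>Distributive lattices and spatial frames\<close>

locale distributive_lattice = lattice L for L (structure) +
  assumes meet_join_distrib: "\<lbrakk>x \<in> carrier L; y \<in> carrier L; z \<in> carrier L\<rbrakk>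
            \<Longrightarrow> x \<sqinter> (y \<squnion> z) = (x \<sqinter> y) \<squnion> (x \<sqinter> z)"

locale frame = complete_lattice L for L (structure) +
  assumes meet_Join_distrib: "\<lbrakk>x \<in> carrier L; A \<subseteq> carrier L\<rbrakk>
            \<Longrightarrow> x \<sqinter> (\<Squnion>A) = \<Squnion>((\<lambda>a. x \<sqinter> a) ` A)"

text \<open>The poset \<open>{0 \<le> 1}\<close> is the type \<^typ>\<open>bool\<close>; its joins and meets in the library are
  \<^const>\<open>Sup\<close> and \<^const>\<open>Inf\<close>.\<close>

definition frame_point :: "('b, 'z) gorder_scheme \<Rightarrow> ('b \<Rightarrow> bool) \<Rightarrow> bool" where
  "frame_point L p \<longleftrightarrow>
     (\<forall>x \<in> carrier L. \<forall>y \<in> carrier L. x \<sqsubseteq>\<^bsub>L\<^esub> y \<longrightarrow> p x \<le> p y) \<and>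
     (\<forall>A. A \<subseteq> carrier L \<and> finite A \<longrightarrow> p (\<Sqinter>\<^bsub>L\<^esub>A) = Inf (p ` A)) \<and>
     (\<forall>A. A \<subseteq> carrier L \<longrightarrow> p (\<Squnion>\<^bsub>L\<^esub>A) = Sup (p ` A))"

definition spatial_frame :: "('b, 'z) gorder_scheme \<Rightarrow> bool" where
  "spatial_frame L \<longleftrightarrow> frame L \<and>
     (\<forall>a \<in> carrier L. \<forall>b \<in> carrier L. \<not> a \<sqsubseteq>\<^bsub>L\<^esub> b \<longrightarrow>
        (\<exists>p. frame_point L p \<and> p a = True \<and> p b = False))"

end

theory Submission
  imports Defs
begin

text \<open>
  Being thick is a finitary closure condition: each clause that puts an object into a thick
  subcategory looks at no more than two objects already there. Hence thick subcategories are stable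
  under arbitrary intersections and under unions of nonempty chains. From here on the
  argument is lattice theory, valid for every distributive lattice of subsets of a set with these
  two stability properties (an algebraic lattice).

  The key step is a separation property. Let \<open>x \<notin> B\<close>. As chains may be united, Zorn's lemma gives
  an \<open>M \<supseteq> B\<close> that is maximal among the members avoiding \<open>x\<close> (\<open>exists_maximal_avoiding\<close>). Such an
  \<open>M\<close> is meet-prime (\<open>maximal_avoiding_is_prime\<close>): if neither \<open>U\<close> nor \<open>V\<close> is contained in \<open>M\<close>, then
  \<open>x\<close> lies in \<open>(M \<squnion> U) \<sqinter> (M \<squnion> V)\<close>, which is \<open>M \<squnion> (U \<sqinter> V)\<close> by distributivity, so \<open>U \<sqinter> V\<close> is not
  contained in \<open>M\<close> either.

  There are therefore enough meet-primes: every member is the intersection of the primes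
  above it (\<open>prime_separation\<close>). This yields both halves of the claim. For the
  frame law it suffices to compare the primes above \<open>U \<sqinter> \<Squnion>A\<close> and above \<open>\<Squnion>{U \<sqinter> a | a \<in> A}\<close>; in both
  cases they are those lying above \<open>U\<close> or above all of \<open>A\<close>. For spatiality, a prime \<open>M\<close> is turned into the point that sends \<open>U\<close> to the
  truth value of \<open>\<not> U \<subseteq> M\<close>.
\<close>

section \<open>Algebraic closure systems\<close>

definition inclusion_order :: "'x set set \<Rightarrow> 'x set gorder" where
  "inclusion_order F = \<lparr>carrier = F, eq = (=), le = (\<subseteq>)\<rparr>"

lemma inclusion_order_simps [simp]:
  "carrier (inclusion_order F) = F"
  "le (inclusion_order F) = (\<subseteq>)"
  "eq (inclusion_order F) = (=)"
  by (simp_all add: inclusion_order_def)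

text \<open>
  The greatest member is assumed separately because the empty intersection, as a set of the ambient
  type, would be the whole type. The empty chain is excluded because its union is the empty set,
  which misses the zero objects and so is not thick.
\<close>

locale algebraic_closure_system =
  fixes F :: "'x set set"
  assumes greatest_member: "\<Union>F \<in> F"
    and Inter_closed: "\<lbrakk>A \<subseteq> F; A \<noteq> {}\<rbrakk> \<Longrightarrow> \<Inter>A \<in> F"
    and chain_Union_closed: "\<lbrakk>subset.chain F A; A \<noteq> {}\<rbrakk> \<Longrightarrow> \<Union>A \<in> F"
begin

abbreviation L :: "'x set gorder" where
  "L \<equiv> inclusion_order F"

sublocale complete_lattice L
proof -
  interpret partial_order L
    by unfold_locales auto
  show "complete_lattice L"
  proof (rule complete_lattice_criterion1)
    show "\<exists>g. greatest L g (carrier L)"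
      using greatest_member by (auto simp: greatest_def)
  next
    fix A
    assume "A \<subseteq> carrier L" "A \<noteq> {}"
    then have "greatest L (\<Inter>A) (Lower L A)"
      using Inter_closed[of A] by (intro greatest_LowerI) (auto simp: Lower_def)
    then show "\<exists>i. greatest L i (Lower L A)" ..
  qed
qed

lemma Meet_eq_Inter:
  assumes "A \<subseteq> F" "A \<noteq> {}"
  shows "\<Sqinter>\<^bsub>L\<^esub>A = \<Inter>A"
proof
  show "\<Sqinter>\<^bsub>L\<^esub>A \<subseteq> \<Inter>A"
    using inf_lower[of A] assms(1) by auto
  show "\<Inter>A \<subseteq> \<Sqinter>\<^bsub>L\<^esub>A"
    using inf_greatest[of A "\<Inter>A"] Inter_closed[OF assms] assms(1) by auto
qed

lemma meet_eq_Int: "\<lbrakk>U \<in> F; V \<in> F\<rbrakk> \<Longrightarrow> U \<sqinter>\<^bsub>L\<^esub> V = U \<inter> V"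
  unfolding meet_def by (simp add: Meet_eq_Inter)

lemma Int_closed: "\<lbrakk>U \<in> F; V \<in> F\<rbrakk> \<Longrightarrow> U \<inter> V \<in> F"
  using Inter_closed[of "{U, V}"] by simp

lemma Meet_empty: "\<Sqinter>\<^bsub>L\<^esub>{} = \<Union>F"
  using inf_greatest[of "{}" "\<Union>F"] inf_closed[of "{}"] greatest_member by auto

lemma Join_subset_iff:
  assumes "A \<subseteq> F" "M \<in> F"
  shows "\<Squnion>\<^bsub>L\<^esub>A \<subseteq> M \<longleftrightarrow> (\<forall>a\<in>A. a \<subseteq> M)"
  using sup_upper[of A] sup_least[of A M] assms by auto

lemma join_subset_iff:
  assumes "U \<in> F" "V \<in> F" "M \<in> F"
  shows "U \<squnion>\<^bsub>L\<^esub> V \<subseteq> M \<longleftrightarrow> U \<subseteq> M \<and> V \<subseteq> M"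
  unfolding join_def using assms by (simp add: Join_subset_iff)

lemma join_closed_F: "\<lbrakk>U \<in> F; V \<in> F\<rbrakk> \<Longrightarrow> U \<squnion>\<^bsub>L\<^esub> V \<in> F"
  using join_closed[of U V] by simp

section \<open>Prime members and points\<close>

definition prime_member :: "'x set \<Rightarrow> bool" where
  "prime_member M \<longleftrightarrow> M \<in> F \<and> M \<noteq> \<Union>F \<and>
     (\<forall>U\<in>F. \<forall>V\<in>F. U \<inter> V \<subseteq> M \<longrightarrow> U \<subseteq> M \<or> V \<subseteq> M)"

lemma prime_member_Inter:
  assumes "prime_member M" "finite A" "A \<noteq> {}" "A \<subseteq> F" "\<Inter>A \<subseteq> M"
  shows "\<exists>a\<in>A. a \<subseteq> M"
  using assms(2-5)
proof (induction A rule: finite_ne_induct)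
  case (singleton a)
  then show ?case by simp
next
  case (insert a A)
  then have "\<Inter>A \<in> F"
    using Inter_closed by simp
  then have "a \<subseteq> M \<or> \<Inter>A \<subseteq> M"
    using assms(1) insert.prems by (simp add: prime_member_def)
  then show ?case
    using insert by auto
qed

text \<open>
  A map to truth values preserving arbitrary joins has a largest member \<open>M\<close> on which it is false,
  and is false exactly below \<open>M\<close>. Primality of \<open>M\<close> is what makes it preserve finite meets, with
  \<open>M \<noteq> \<Union>F\<close> accounting for the empty meet.
\<close>

lemma frame_point_of_prime:
  assumes "prime_member M"
  shows "frame_point L (\<lambda>U. \<not> U \<subseteq> M)"
  unfolding frame_point_def
proof (intro conjI allI impI ballI)
  have M: "M \<in> F" "M \<noteq> \<Union>F"
    using assms by (simp_all add: prime_member_def)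
  fix A
  assume A: "A \<subseteq> carrier L \<and> finite A"
  show "(\<not> \<Sqinter>\<^bsub>L\<^esub>A \<subseteq> M) = Inf ((\<lambda>U. \<not> U \<subseteq> M) ` A)"
  proof (cases "A = {}")
    case True
    moreover have "\<not> \<Union>F \<subseteq> M"
      using M by blast
    ultimately show ?thesis
      by (simp add: Meet_empty)
  next
    case False
    then have "\<Inter>A \<subseteq> M \<longleftrightarrow> (\<exists>a\<in>A. a \<subseteq> M)"
      using prime_member_Inter[OF assms] A by auto
    then show ?thesis
      using False A by (simp add: Meet_eq_Inter)
  qed
next
  fix A
  assume "A \<subseteq> carrier L"
  then show "(\<not> \<Squnion>\<^bsub>L\<^esub>A \<subseteq> M) = Sup ((\<lambda>U. \<not> U \<subseteq> M) ` A)"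
    using assms by (simp add: Join_subset_iff prime_member_def)
qed auto

section \<open>Separation by prime members\<close>

lemma exists_maximal_avoiding:
  assumes "B \<in> F" "x \<notin> B"
  shows "\<exists>M\<in>F. B \<subseteq> M \<and> x \<notin> M \<and> (\<forall>N\<in>F. M \<subseteq> N \<longrightarrow> x \<notin> N \<longrightarrow> N = M)"
proof -
  let ?S = "{N \<in> F. B \<subseteq> N \<and> x \<notin> N}"
  have "\<exists>M\<in>?S. \<forall>N\<in>?S. M \<subseteq> N \<longrightarrow> N = M"
  proof (rule subset_Zorn_nonempty)
    show "?S \<noteq> {}"
      using assms by blast
    fix C
    assume "C \<noteq> {}" and C: "subset.chain ?S C"
    moreover have "subset.chain F C"
      using C by (auto simp: subset.chain_def)
    ultimately have "\<Union>C \<in> F"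
      using chain_Union_closed by blast
    then show "\<Union>C \<in> ?S"
      using C \<open>C \<noteq> {}\<close> by (fastforce simp: subset.chain_def)
  qed
  then obtain M where M: "M \<in> ?S" "\<forall>N\<in>?S. M \<subseteq> N \<longrightarrow> N = M"
    by (rule bexE)
  show ?thesis
  proof (intro bexI conjI ballI impI)
    show "N = M" if "N \<in> F" "M \<subseteq> N" "x \<notin> N" for N
      using M(1) M(2)[rule_format, of N] that by auto
  qed (use M(1) in simp_all)
qed

text \<open>
  The distributive law is assumed in the form \<open>\<sqinter>\<close> over \<open>\<squnion>\<close>, whereas primality uses the dual
  form; the converse inequality holds in every lattice.
\<close>

lemma join_meet_distrib_le:
  assumes "distributive_lattice L" and F: "M \<in> F" "U \<in> F" "V \<in> F"
  shows "(M \<squnion>\<^bsub>L\<^esub> U) \<inter> (M \<squnion>\<^bsub>L\<^esub> V) \<subseteq> M \<squnion>\<^bsub>L\<^esub> (U \<inter> V)"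
proof -
  interpret distributive_lattice L by fact
  have distrib: "X \<inter> (Y \<squnion>\<^bsub>L\<^esub> Z) = (X \<inter> Y) \<squnion>\<^bsub>L\<^esub> (X \<inter> Z)"
    if "X \<in> F" "Y \<in> F" "Z \<in> F" for X Y Z
    using meet_join_distrib[of X Y Z] that by (simp add: meet_eq_Int join_closed_F)
  let ?J = "M \<squnion>\<^bsub>L\<^esub> (U \<inter> V)"
  have J: "?J \<in> F" "M \<subseteq> ?J" "U \<inter> V \<subseteq> ?J"
    using join_closed_F[of M "U \<inter> V"] join_subset_iff[of M "U \<inter> V" ?J] F Int_closed by auto
  have "V \<inter> (M \<squnion>\<^bsub>L\<^esub> U) = (V \<inter> M) \<squnion>\<^bsub>L\<^esub> (V \<inter> U)"
    using distrib F by simp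
  also have "\<dots> \<subseteq> ?J"
    using J F by (subst join_subset_iff) (auto intro: Int_closed)
  finally have V: "V \<inter> (M \<squnion>\<^bsub>L\<^esub> U) \<subseteq> ?J" .
  have "(M \<squnion>\<^bsub>L\<^esub> U) \<inter> (M \<squnion>\<^bsub>L\<^esub> V) = ((M \<squnion>\<^bsub>L\<^esub> U) \<inter> M) \<squnion>\<^bsub>L\<^esub> ((M \<squnion>\<^bsub>L\<^esub> U) \<inter> V)"
    using distrib F join_closed_F by simp
  also have "\<dots> \<subseteq> ?J"
    using J V F by (subst join_subset_iff) (auto intro: Int_closed join_closed_F)
  finally show ?thesis .
qed

lemma maximal_avoiding_is_prime:
  assumes "distributive_lattice L" "M \<in> F" "x \<in> \<Union>F" "x \<notin> M"
    and max: "\<And>N. \<lbrakk>N \<in> F; M \<subseteq> N; x \<notin> N\<rbrakk> \<Longrightarrow> N = M"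
  shows "prime_member M"
proof -
  have "x \<in> M \<squnion>\<^bsub>L\<^esub> U" if "U \<in> F" "\<not> U \<subseteq> M" for U
    using join_closed_F[of M U] join_subset_iff[of M U "M \<squnion>\<^bsub>L\<^esub> U"] max that assms(2) by blast
  moreover have "M \<squnion>\<^bsub>L\<^esub> (U \<inter> V) \<subseteq> M" if "U \<in> F" "V \<in> F" "U \<inter> V \<subseteq> M" for U V
    using that assms(2) Int_closed by (simp add: join_subset_iff)
  ultimately have "U \<subseteq> M \<or> V \<subseteq> M" if "U \<in> F" "V \<in> F" "U \<inter> V \<subseteq> M" for U V
    using join_meet_distrib_le[OF assms(1,2)] that assms(4) by blast
  then show ?thesis
    using assms(2-4) by (auto simp: prime_member_def)
qed

lemma prime_separation:
  assumes "distributive_lattice L" "A \<in> F" "B \<in> F" "\<not> A \<subseteq> B"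
  shows "\<exists>M. prime_member M \<and> B \<subseteq> M \<and> \<not> A \<subseteq> M"
proof -
  obtain x where x: "x \<in> A" "x \<notin> B"
    using assms(4) by blast
  then obtain M where M: "M \<in> F" "B \<subseteq> M" "x \<notin> M"
    and "\<forall>N\<in>F. M \<subseteq> N \<longrightarrow> x \<notin> N \<longrightarrow> N = M"
    using exists_maximal_avoiding assms(3) by blast
  then have "prime_member M"
    using maximal_avoiding_is_prime[OF assms(1), of M x] x assms(2) by blast
  then show ?thesis
    using M x by blast
qed

lemma frame_of_distributive:
  assumes "distributive_lattice L"
  shows "frame L"
proof
  fix U A
  assume "U \<in> carrier L" "A \<subseteq> carrier L"
  then have F: "U \<in> F" "A \<subseteq> F"
    by simp_all
  let ?R = "\<Squnion>\<^bsub>L\<^esub>((\<lambda>a. U \<sqinter>\<^bsub>L\<^esub> a) ` A)"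
  have meet: "U \<sqinter>\<^bsub>L\<^esub> a = U \<inter> a" if "a \<in> A" for a
    using meet_eq_Int F that by blast
  have image: "(\<lambda>a. U \<sqinter>\<^bsub>L\<^esub> a) ` A \<subseteq> F"
    using F meet Int_closed by auto
  have Join_closed: "\<Squnion>\<^bsub>L\<^esub>B \<in> F" if "B \<subseteq> F" for B
    using sup_closed[of B] that by simp
  note J = Join_closed[OF F(2)] and R = Join_closed[OF image]
  have "a \<subseteq> \<Squnion>\<^bsub>L\<^esub>A" if "a \<in> A" for a
    using Join_subset_iff[OF F(2) J] that by simp
  then have "\<forall>b \<in> (\<lambda>a. U \<sqinter>\<^bsub>L\<^esub> a) ` A. b \<subseteq> U \<inter> \<Squnion>\<^bsub>L\<^esub>A"
    using meet by fastforce
  then have "?R \<subseteq> U \<inter> \<Squnion>\<^bsub>L\<^esub>A"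
    using Join_subset_iff[OF image Int_closed[OF F(1) J]] by simp
  moreover have "U \<inter> \<Squnion>\<^bsub>L\<^esub>A \<subseteq> ?R"
  proof (rule ccontr)
    assume "\<not> U \<inter> \<Squnion>\<^bsub>L\<^esub>A \<subseteq> ?R"
    then obtain M where M: "prime_member M" "?R \<subseteq> M" "\<not> U \<inter> \<Squnion>\<^bsub>L\<^esub>A \<subseteq> M"
      using prime_separation[OF assms Int_closed[OF F(1) J] R] by metis
    have "M \<in> F"
      using M(1) by (simp add: prime_member_def)
    then have "U \<inter> a \<subseteq> M" if "a \<in> A" for a
      using M(2) Join_subset_iff[OF image] meet[OF that] that by force
    moreover have "\<not> U \<subseteq> M"
      using M(3) by blast
    ultimately have "a \<subseteq> M" if "a \<in> A" for a
      using M(1) F that unfolding prime_member_def by blast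
    then have "\<Squnion>\<^bsub>L\<^esub>A \<subseteq> M"
      using Join_subset_iff[OF F(2) \<open>M \<in> F\<close>] by blast
    then show False
      using M(3) by blast
  qed
  ultimately show "U \<sqinter>\<^bsub>L\<^esub> \<Squnion>\<^bsub>L\<^esub>A = ?R"
    using meet_eq_Int[OF F(1) J] subset_antisym by metis
qed

lemma spatial_frame_of_distributive:
  assumes "distributive_lattice L"
  shows "spatial_frame L"
  unfolding spatial_frame_def
proof (intro conjI ballI impI)
  show "frame L"
    using frame_of_distributive[OF assms] .
next
  fix A B
  assume "A \<in> carrier L" "B \<in> carrier L" "\<not> A \<sqsubseteq>\<^bsub>L\<^esub> B"
  then obtain M where "prime_member M" "B \<subseteq> M" "\<not> A \<subseteq> M"
    using prime_separation[OF assms, of A B] by auto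
  then show "\<exists>p. frame_point L p \<and> p A = True \<and> p B = False"
    using frame_point_of_prime by blast
qed

end

section \<open>Thick subcategories\<close>

lemma thick_subcategoryI:
  assumes "M \<subseteq> Obj K"
    and "\<And>Z. zero_object K Z \<Longrightarrow> Z \<in> M"
    and "\<And>X Y. \<lbrakk>X \<in> M; isomorphic_objects K X Y\<rbrakk> \<Longrightarrow> Y \<in> M"
    and "\<And>X. X \<in> M \<Longrightarrow> Sus0 K X \<in> M"
    and "\<And>X. \<lbrakk>X \<in> Obj K; Sus0 K X \<in> M\<rbrakk> \<Longrightarrow> X \<in> M"
    and "\<And>X Y Z f g h. \<lbrakk>distinguished K X Y Z f g h; X \<in> M; Y \<in> M\<rbrakk> \<Longrightarrow> Z \<in> M"
    and "\<And>X Y B. \<lbrakk>biproduct K X Y B; B \<in> M\<rbrakk> \<Longrightarrow> X \<in> M \<and> Y \<in> M"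
  shows "thick_subcategory K M"
  unfolding thick_subcategory_def
  by (intro conjI allI impI ballI; (elim conjE)?;
      rule assms(1-6) assms(7)[THEN conjunct1] assms(7)[THEN conjunct2]; assumption)

lemma thick_subcategoryD:
  assumes "thick_subcategory K M"
  shows "M \<subseteq> Obj K"
    and "zero_object K Z \<Longrightarrow> Z \<in> M"
    and "\<lbrakk>X \<in> M; isomorphic_objects K X Y\<rbrakk> \<Longrightarrow> Y \<in> M"
    and "X \<in> M \<Longrightarrow> Sus0 K X \<in> M"
    and "\<lbrakk>X \<in> Obj K; Sus0 K X \<in> M\<rbrakk> \<Longrightarrow> X \<in> M"
    and "\<lbrakk>distinguished K X Y Z f g h; X \<in> M; Y \<in> M\<rbrakk> \<Longrightarrow> Z \<in> M"
    and "\<lbrakk>biproduct K X Y B; B \<in> M\<rbrakk> \<Longrightarrow> X \<in> M \<and> Y \<in> M"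
  using assms unfolding thick_subcategory_def by blast+

lemma (in triangulated_category) thick_Obj: "thick_subcategory K (Obj K)"
proof (rule thick_subcategoryI)
  show "Sus0 K X \<in> Obj K" if "X \<in> Obj K" for X
    using suspension_autoequivalence that
    by (simp add: autoequivalence_def endofunctor_def)
qed (auto simp: zero_object_def isomorphic_objects_def distinguished_def triangle_def
      biproduct_def)

lemma thick_Inter:
  assumes thick: "\<And>M. M \<in> A \<Longrightarrow> thick_subcategory K M" and "A \<noteq> {}"
  shows "thick_subcategory K (\<Inter>A)"
proof (rule thick_subcategoryI)
  show "\<Inter>A \<subseteq> Obj K"
    using thick_subcategoryD(1)[OF thick] \<open>A \<noteq> {}\<close> by blast
  show "Z \<in> \<Inter>A" if "zero_object K Z" for Z
    using thick_subcategoryD(2)[OF thick that] by blast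
  show "Y \<in> \<Inter>A" if "X \<in> \<Inter>A" "isomorphic_objects K X Y" for X Y
    using thick_subcategoryD(3)[OF thick _ that(2)] that(1) by blast
  show "Sus0 K X \<in> \<Inter>A" if "X \<in> \<Inter>A" for X
    using thick_subcategoryD(4)[OF thick, of _ X] that by blast
  show "X \<in> \<Inter>A" if "X \<in> Obj K" "Sus0 K X \<in> \<Inter>A" for X
    using thick_subcategoryD(5)[OF thick that(1)] that(2) by blast
  show "Z \<in> \<Inter>A" if "distinguished K X Y Z f g h" "X \<in> \<Inter>A" "Y \<in> \<Inter>A" for X Y Z f g h
    using thick_subcategoryD(6)[OF thick that(1)] that(2,3) by blast
  show "X \<in> \<Inter>A \<and> Y \<in> \<Inter>A" if "biproduct K X Y B" "B \<in> \<Inter>A" for X Y B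
    using thick_subcategoryD(7)[OF thick that(1)] that(2) by blast
qed

text \<open>
  Closure under cones is the only condition that starts from two objects of the subcategory; in a
  chain both already lie in a common member.
\<close>

lemma thick_Union_chain:
  assumes thick: "\<And>M. M \<in> A \<Longrightarrow> thick_subcategory K M"
    and "A \<noteq> {}" and chain: "\<And>M N. \<lbrakk>M \<in> A; N \<in> A\<rbrakk> \<Longrightarrow> M \<subseteq> N \<or> N \<subseteq> M"
  shows "thick_subcategory K (\<Union>A)"
proof (rule thick_subcategoryI)
  show "\<Union>A \<subseteq> Obj K"
    using thick_subcategoryD(1)[OF thick] by blast
  show "Z \<in> \<Union>A" if "zero_object K Z" for Z
    using thick_subcategoryD(2)[OF thick that] \<open>A \<noteq> {}\<close> by blast
  show "Y \<in> \<Union>A" if "X \<in> \<Union>A" "isomorphic_objects K X Y" for X Y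
    using thick_subcategoryD(3)[OF thick _ that(2)] that(1) by blast
  show "Sus0 K X \<in> \<Union>A" if "X \<in> \<Union>A" for X
    using thick_subcategoryD(4)[OF thick, of _ X] that by blast
  show "X \<in> \<Union>A" if "X \<in> Obj K" "Sus0 K X \<in> \<Union>A" for X
    using thick_subcategoryD(5)[OF thick that(1)] that(2) by blast
  show "Z \<in> \<Union>A"
    if tri: "distinguished K X Y Z f g h" and XY: "X \<in> \<Union>A" "Y \<in> \<Union>A" for X Y Z f g h
  proof -
    obtain M N where "M \<in> A" "X \<in> M" "N \<in> A" "Y \<in> N"
      using XY by blast
    then obtain P where "P \<in> A" "X \<in> P" "Y \<in> P"
      using chain[of M N] by blast
    then show ?thesis
      using thick_subcategoryD(6)[OF thick tri] by blast
  qed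
  show "X \<in> \<Union>A \<and> Y \<in> \<Union>A" if "biproduct K X Y B" "B \<in> \<Union>A" for X Y B
    using thick_subcategoryD(7)[OF thick that(1)] that(2) by blast
qed

lemma (in triangulated_category) thick_algebraic_closure_system:
  "algebraic_closure_system {M. thick_subcategory K M}"
proof
  have "\<Union>{M. thick_subcategory K M} = Obj K"
    using thick_Obj thick_subcategoryD(1) by blast
  then show "\<Union>{M. thick_subcategory K M} \<in> {M. thick_subcategory K M}"
    using thick_Obj by simp
next
  show "\<Inter>A \<in> {M. thick_subcategory K M}" if "A \<subseteq> {M. thick_subcategory K M}" "A \<noteq> {}" for A
    using thick_Inter[of A K] that by blast
next
  show "\<Union>A \<in> {M. thick_subcategory K M}"
    if "subset.chain {M. thick_subcategory K M} A" "A \<noteq> {}" for A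
    using thick_Union_chain[of A K] that unfolding subset_chain_def by blast
qed

theorem corollary4p3p2:
  fixes K :: "('o, 'a) triangulated_data"
  assumes "triangulated_category K"
    and "distributive_lattice (Thick K)"
  shows "spatial_frame (Thick K)"
proof -
  interpret triangulated_category K by fact
  interpret thick: algebraic_closure_system "{M. thick_subcategory K M}"
    by (rule thick_algebraic_closure_system)
  have "Thick K = inclusion_order {M. thick_subcategory K M}"
    by (simp add: Thick_def inclusion_order_def)
  then show ?thesis
    using thick.spatial_frame_of_distributive assms(2) by simp
qed

end
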